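(* The logic $\mathsf L(\mathfrak C_5)$ has finitary unification.
   Context: A frame is a finite poset with a least element; $\mathsf L(\mathfrak F)$ is the set of intuitionistic formulas valid in all Kripke models over $\mathfrak F$. $\mathfrak C_5$ is the six-element frame with elements $r,a,b,c,t,d$ where $r<a$, $r<b$, $a<c$, $a<t$, $b<t$, $b<d$ (and the relations following by transitivity), $c,t,d$ maximal, and no other relations. For an intermediate logic $\mathsf L$, a substitution $\sigma$ is an $\mathsf L$-unifier of $A$ if $\sigma(A)\in\mathsf L$; $\varepsilon\preccurlyeq\mu$ iff $\alpha\circ\varepsilon=_{\mathsf L}\mu$ for some substitution $\alpha$; a set $\Sigma$ of unifiers of $A$ is complete if each unifier of $A$ is $\succcurlyeq$ some member of $\Sigma$. Unification is finitary if it is not unitary (some unifiable formula has no single-element complete set) and every unifiable formula has a finite complete set of unifiers. *)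

theory Defs
  imports Main
begin

text \<open>Intuitionistic formulas over countably many variables.\<close>

datatype form =
    Var nat
  | Falsum
  | Conj form form
  | Disj form form
  | Impl form form

definition Iff :: "form \<Rightarrow> form \<Rightarrow> form" where
  "Iff A B = Conj (Impl A B) (Impl B A)"

text \<open>The order of a frame is given as the set of pairs \<open>(x, y)\<close> with \<open>x \<le> y\<close>.\<close>

definition frame :: "'w set \<Rightarrow> 'w rel \<Rightarrow> bool" where
  "frame W R \<longleftrightarrow> finite W \<and> partial_order_on W R \<and> (\<exists>r\<in>W. \<forall>x\<in>W. (r, x) \<in> R)"

definition persistent :: "'w set \<Rightarrow> 'w rel \<Rightarrow> ('w \<Rightarrow> nat \<Rightarrow> bool) \<Rightarrow> bool" where
  "persistent W R V \<longleftrightarrow> (\<forall>x\<in>W. \<forall>y\<in>W. \<forall>p. (x, y) \<in> R \<longrightarrow> V x p \<longrightarrow> V y p)"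

fun forces :: "'w set \<Rightarrow> 'w rel \<Rightarrow> ('w \<Rightarrow> nat \<Rightarrow> bool) \<Rightarrow> 'w \<Rightarrow> form \<Rightarrow> bool" where
  "forces W R V x (Var p) \<longleftrightarrow> V x p"
| "forces W R V x Falsum \<longleftrightarrow> False"
| "forces W R V x (Conj A B) \<longleftrightarrow> forces W R V x A \<and> forces W R V x B"
| "forces W R V x (Disj A B) \<longleftrightarrow> forces W R V x A \<or> forces W R V x B"
| "forces W R V x (Impl A B) \<longleftrightarrow>
     (\<forall>y\<in>W. (x, y) \<in> R \<longrightarrow> forces W R V y A \<longrightarrow> forces W R V y B)"

definition logic_of :: "'w set \<Rightarrow> 'w rel \<Rightarrow> form set" where
  "logic_of W R = {A. \<forall>V. persistent W R V \<longrightarrow> (\<forall>x\<in>W. forces W R V x A)}"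

text \<open>
  Substitutions are total maps on the variables, and equality modulo \<open>L\<close> is required on all
  formulas. For the existence of complete sets of a given size this agrees with looking only at
  the variables of the formula to be unified: a unifier given on these finitely many variables
  can be extended by sending the other variables injectively to variables not occurring in its
  values.
\<close>

type_synonym subst = "nat \<Rightarrow> form"

primrec subst_form :: "subst \<Rightarrow> form \<Rightarrow> form" where
  "subst_form \<sigma> (Var p) = \<sigma> p"
| "subst_form \<sigma> Falsum = Falsum"
| "subst_form \<sigma> (Conj A B) = Conj (subst_form \<sigma> A) (subst_form \<sigma> B)"
| "subst_form \<sigma> (Disj A B) = Disj (subst_form \<sigma> A) (subst_form \<sigma> B)"
| "subst_form \<sigma> (Impl A B) = Impl (subst_form \<sigma> A) (subst_form \<sigma> B)"

definition subst_comp :: "subst \<Rightarrow> subst \<Rightarrow> subst" where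
  "subst_comp \<alpha> \<epsilon> = (\<lambda>p. subst_form \<alpha> (\<epsilon> p))"

definition subst_eq :: "form set \<Rightarrow> subst \<Rightarrow> subst \<Rightarrow> bool" where
  "subst_eq L \<sigma> \<tau> \<longleftrightarrow> (\<forall>A. Iff (subst_form \<sigma> A) (subst_form \<tau> A) \<in> L)"

definition unifier :: "form set \<Rightarrow> form \<Rightarrow> subst \<Rightarrow> bool" where
  "unifier L A \<sigma> \<longleftrightarrow> subst_form \<sigma> A \<in> L"

definition unifiable :: "form set \<Rightarrow> form \<Rightarrow> bool" where
  "unifiable L A \<longleftrightarrow> (\<exists>\<sigma>. unifier L A \<sigma>)"

definition more_general :: "form set \<Rightarrow> subst \<Rightarrow> subst \<Rightarrow> bool" where
  "more_general L \<epsilon> \<mu> \<longleftrightarrow> (\<exists>\<alpha>. subst_eq L (subst_comp \<alpha> \<epsilon>) \<mu>)"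

definition complete_unifiers :: "form set \<Rightarrow> form \<Rightarrow> subst set \<Rightarrow> bool" where
  "complete_unifiers L A S \<longleftrightarrow>
     (\<forall>\<sigma>\<in>S. unifier L A \<sigma>) \<and>
     (\<forall>\<mu>. unifier L A \<mu> \<longrightarrow> (\<exists>\<epsilon>\<in>S. more_general L \<epsilon> \<mu>))"

definition unitary_unification :: "form set \<Rightarrow> bool" where
  "unitary_unification L \<longleftrightarrow>
     (\<forall>A. unifiable L A \<longrightarrow> (\<exists>\<sigma>. complete_unifiers L A {\<sigma>}))"

definition finitary_unification :: "form set \<Rightarrow> bool" where
  "finitary_unification L \<longleftrightarrow>
     \<not> unitary_unification L \<and>
     (\<forall>A. unifiable L A \<longrightarrow> (\<exists>S. finite S \<and> complete_unifiers L A S))"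

datatype C5 = C5_r | C5_a | C5_b | C5_c | C5_t | C5_d

definition C5_le :: "C5 rel" where
  "C5_le = {(C5_r, C5_a), (C5_r, C5_b), (C5_a, C5_c), (C5_a, C5_t), (C5_b, C5_t), (C5_b, C5_d)}\<^sup>*"

lemma C5_le_iff:
  "(x, y) \<in> C5_le \<longleftrightarrow>
     x = y \<or> x = C5_r \<or> x = C5_a \<and> y \<in> {C5_c, C5_t} \<or> x = C5_b \<and> y \<in> {C5_t, C5_d}"
  (is "_ \<longleftrightarrow> ?P x y")
proof
  assume "(x, y) \<in> C5_le"
  then show "?P x y"
    unfolding C5_le_def by (induction rule: rtrancl_induct) auto
next
  let ?E = "{(C5_r, C5_a), (C5_r, C5_b), (C5_a, C5_c), (C5_a, C5_t), (C5_b, C5_t), (C5_b, C5_d)}"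
  have e: "(C5_r, C5_a) \<in> ?E\<^sup>*" "(C5_r, C5_b) \<in> ?E\<^sup>*" "(C5_a, C5_c) \<in> ?E\<^sup>*"
    "(C5_a, C5_t) \<in> ?E\<^sup>*" "(C5_b, C5_t) \<in> ?E\<^sup>*" "(C5_b, C5_d) \<in> ?E\<^sup>*"
    by (intro r_into_rtrancl, simp)+
  have "(C5_r, C5_c) \<in> ?E\<^sup>*" "(C5_r, C5_t) \<in> ?E\<^sup>*" "(C5_r, C5_d) \<in> ?E\<^sup>*"
    by (rule rtrancl_trans[OF e(1) e(3)], rule rtrancl_trans[OF e(1) e(4)],
        rule rtrancl_trans[OF e(2) e(6)])
  moreover assume "?P x y"
  ultimately show "(x, y) \<in> C5_le"
    using e unfolding C5_le_def by (cases y) (auto simp del: insert_iff)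
qed

lemma frame_C5: "frame (UNIV :: C5 set) C5_le"
proof -
  have "(UNIV :: C5 set) = {C5_r, C5_a, C5_b, C5_c, C5_t, C5_d}"
    using C5.exhaust by blast
  then have "finite (UNIV :: C5 set)"
    by (metis finite.emptyI finite_insert)
  moreover have "partial_order_on UNIV C5_le"
    unfolding partial_order_on_def preorder_on_def refl_on_def trans_def antisym_def
    by (auto simp: C5_le_iff)
  moreover have "\<forall>x. (C5_r, x) \<in> C5_le"
    by (simp add: C5_le_iff)
  ultimately show ?thesis
    unfolding frame_def by blast
qed

end

(*
  Read semantically, a substitution turns models on C5 over its target variables into models over
  its source variables. Given a unifier \<sigma> of a formula in n variables, remember for each maximal
  label v the \<sigma>-image of v and the set D v of \<sigma>-images of forks with one end v. These data,
  added as extra variables whose number depends only on n, suffice to rebuild a unifier: two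
  forks of C5 share a single maximal point, so forks recorded in D of that point can be glued to a
  model whose \<sigma>-image is again a model of the formula. Hence every unifier has a more general one
  with a bounded number of variables, and up to equivalence there are finitely many of these.
  A most general unifier of p \<or> \<not> p fails because C5 has two incompatible maximal points.
*)

theory Submission
  imports Defs
begin

section \<open>Definability over \<open>C5\<close>\<close>

type_synonym val = "C5 \<Rightarrow> nat \<Rightarrow> bool"

abbreviation le :: "C5 \<Rightarrow> C5 \<Rightarrow> bool" where
  "le x y \<equiv> (x, y) \<in> C5_le"

abbreviation fc :: "val \<Rightarrow> C5 \<Rightarrow> form \<Rightarrow> bool" where
  "fc \<equiv> forces UNIV C5_le"

abbreviation pers :: "val \<Rightarrow> bool" where
  "pers \<equiv> persistent UNIV C5_le"

abbreviation LC5 :: "form set" where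
  "LC5 \<equiv> logic_of UNIV C5_le"

primrec vars :: "form \<Rightarrow> nat set" where
  "vars (Var p) = {p}"
| "vars Falsum = {}"
| "vars (Conj A B) = vars A \<union> vars B"
| "vars (Disj A B) = vars A \<union> vars B"
| "vars (Impl A B) = vars A \<union> vars B"

lemma finite_vars: "finite (vars A)"
  by (induction A) auto

lemma finite_C5: "finite (UNIV :: C5 set)"
  using frame_C5 by (simp add: frame_def)

lemma le_refl [simp]: "le x x"
  by (simp add: C5_le_iff)

lemma le_trans: "le x y \<Longrightarrow> le y z \<Longrightarrow> le x z"
  unfolding C5_le_def by (rule rtrancl_trans)

lemma le_r [simp]: "le C5_r x"
  by (simp add: C5_le_iff)

lemma le_max [simp]:
  "le C5_c x \<longleftrightarrow> x = C5_c" "le C5_t x \<longleftrightarrow> x = C5_t" "le C5_d x \<longleftrightarrow> x = C5_d"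
  by (auto simp: C5_le_iff)

lemma persI: "(\<And>x y. le x y \<Longrightarrow> V x \<le> V y) \<Longrightarrow> pers V"
  by (auto simp: persistent_def le_fun_def)

lemma persD: "pers V \<Longrightarrow> le x y \<Longrightarrow> V x \<le> V y"
  by (auto simp: persistent_def le_fun_def)

lemma fc_mono:
  assumes "pers V" "le x y" "fc V x B"
  shows "fc V y B"
  using assms(2,3)
proof (induction B arbitrary: x y)
  case (Var p)
  then show ?case using persD[OF assms(1)] by (auto simp: le_fun_def)
next
  case (Impl B1 B2)
  have "fc V z B2" if "le y z" "fc V z B1" for z
    using Impl.prems(2) that le_trans[OF Impl.prems(1) that(1)] by simp
  then show ?case by simp
qed auto

lemma pers_fc: "pers V \<Longrightarrow> pers (\<lambda>x p. fc V x (\<sigma> p))"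
  by (rule persI) (auto intro: fc_mono)

lemma fc_subst: "fc V x (subst_form \<sigma> B) \<longleftrightarrow> fc (\<lambda>y p. fc V y (\<sigma> p)) x B"
  by (induction B arbitrary: x) auto

lemma fc_bisim:
  assumes "Z x x'" "vars B \<subseteq> P"
    and "\<And>y y' p. Z y y' \<Longrightarrow> p \<in> P \<Longrightarrow> V y p = V' y' p"
    and "\<And>y y' z. Z y y' \<Longrightarrow> le y z \<Longrightarrow> \<exists>z'. le y' z' \<and> Z z z'"
    and "\<And>y y' z'. Z y y' \<Longrightarrow> le y' z' \<Longrightarrow> \<exists>z. le y z \<and> Z z z'"
  shows "fc V x B \<longleftrightarrow> fc V' x' B"
  using assms(1,2)
proof (induction B arbitrary: x x')
  case (Var p)
  then show ?case using assms(3) by auto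
next
  case (Impl B1 B2)
  have eq: "fc V y B1 = fc V' y' B1" "fc V y B2 = fc V' y' B2" if "Z y y'" for y y'
    using that Impl.IH Impl.prems(2) by simp_all
  show ?case
  proof
    assume h: "fc V x (Impl B1 B2)"
    have "fc V' z' B2" if z': "le x' z'" "fc V' z' B1" for z'
    proof -
      obtain z where "le x z" "Z z z'" using assms(5)[OF Impl.prems(1) z'(1)] by blast
      then show ?thesis using h z' eq[of z z'] by simp
    qed
    then show "fc V' x' (Impl B1 B2)" by simp
  next
    assume h: "fc V' x' (Impl B1 B2)"
    have "fc V z B2" if z: "le x z" "fc V z B1" for z
    proof -
      obtain z' where "le x' z'" "Z z z'" using assms(4)[OF Impl.prems(1) z(1)] by blast
      then show ?thesis using h z eq[of z z'] by simp
    qed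
    then show "fc V x (Impl B1 B2)" by simp
  qed
qed auto

section \<open>Finite labels, equivalence in boundedly many variables, and definability\<close>

definition trunc :: "nat \<Rightarrow> (nat \<Rightarrow> bool) \<Rightarrow> nat \<Rightarrow> bool" where
  "trunc n f = (\<lambda>p. p < n \<and> f p)"

lemma trunc_eq_iff: "trunc n f = trunc n g \<longleftrightarrow> (\<forall>p<n. f p = g p)"
  by (auto simp: trunc_def fun_eq_iff)

lemma trunc_trunc [simp]: "trunc n (trunc n f) = trunc n f"
  by (auto simp: trunc_def)

lemma trunc_mono: "f \<le> g \<Longrightarrow> trunc n f \<le> trunc n g"
  by (auto simp: trunc_def le_fun_def)

lemma finite_labels: "finite {f. trunc n f = f}"
proof -
  have "{f. trunc n f = f} \<subseteq> (\<lambda>X p. p \<in> X) ` Pow {..<n}"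
  proof
    fix f assume "f \<in> {f. trunc n f = f}"
    then have "trunc n f = f" by simp
    then have "\<And>p. f p \<Longrightarrow> p < n" unfolding trunc_def by metis
    then have "f = (\<lambda>p. p \<in> Collect f)" "Collect f \<in> Pow {..<n}" by auto
    then show "f \<in> (\<lambda>X p. p \<in> X) ` Pow {..<n}" by blast
  qed
  then show ?thesis by (rule finite_subset) simp
qed

text \<open>Defined by theories, so that symmetry and transitivity are immediate. For persistent
  valuations it is also the largest bisimulation on \<open>m\<close>-labels:
  \<open>eqv_bisim\<close> gives one direction, \<open>eqv_label\<close>, \<open>eqv_forth\<close>
  and \<open>eqv_back\<close> the other.\<close>

definition eqv :: "nat \<Rightarrow> val \<Rightarrow> C5 \<Rightarrow> val \<Rightarrow> C5 \<Rightarrow> bool" where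
  "eqv m V x V' x' \<longleftrightarrow> (\<forall>B. vars B \<subseteq> {..<m} \<longrightarrow> fc V x B = fc V' x' B)"

lemma eqv_refl: "eqv m V x V x"
  and eqv_sym: "eqv m V x V' x' \<Longrightarrow> eqv m V' x' V x"
  and eqv_trans: "eqv m V x V' x' \<Longrightarrow> eqv m V' x' V'' x'' \<Longrightarrow> eqv m V x V'' x''"
  by (auto simp: eqv_def)

lemma eqv_bisim:
  assumes "Z x x'"
    and "\<And>y y'. Z y y' \<Longrightarrow> trunc m (V y) = trunc m (V' y')"
    and "\<And>y y' z. Z y y' \<Longrightarrow> le y z \<Longrightarrow> \<exists>z'. le y' z' \<and> Z z z'"
    and "\<And>y y' z'. Z y y' \<Longrightarrow> le y' z' \<Longrightarrow> \<exists>z. le y z \<and> Z z z'"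
  shows "eqv m V x V' x'"
  unfolding eqv_def
proof (intro allI impI)
  fix B assume B: "vars B \<subseteq> {..<m}"
  show "fc V x B = fc V' x' B"
    using assms(2)
    by (intro fc_bisim[where Z = Z and P = "{..<m}", OF assms(1) B _ assms(3,4)])
       (auto simp: trunc_eq_iff)
qed

lemma eqv_label: "eqv m V x V' x' \<Longrightarrow> trunc m (V x) = trunc m (V' x')"
  unfolding eqv_def trunc_eq_iff
proof (intro allI impI)
  fix p assume "\<forall>B. vars B \<subseteq> {..<m} \<longrightarrow> fc V x B = fc V' x' B" "p < m"
  then show "V x p = V' x' p"
    by (auto dest: spec[of _ "Var p"])
qed

lemma ex_big_Conj:
  assumes "finite S" "\<And>s. s \<in> S \<Longrightarrow> vars (f s) \<subseteq> P"
  shows "\<exists>B. vars B \<subseteq> P \<and> (\<forall>V x. fc V x B = (\<forall>s\<in>S. fc V x (f s)))"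
  using assms
proof (induction S rule: finite_induct)
  case empty
  show ?case by (rule exI[of _ "Impl Falsum Falsum"]) simp
next
  case (insert s S)
  then obtain B where "vars B \<subseteq> P" "\<forall>V x. fc V x B = (\<forall>s\<in>S. fc V x (f s))" by auto
  then show ?case using insert.prems by (intro exI[of _ "Conj (f s) B"]) auto
qed

lemma ex_big_Disj:
  assumes "finite S" "\<And>s. s \<in> S \<Longrightarrow> vars (f s) \<subseteq> P"
  shows "\<exists>B. vars B \<subseteq> P \<and> (\<forall>V x. fc V x B = (\<exists>s\<in>S. fc V x (f s)))"
  using assms
proof (induction S rule: finite_induct)
  case empty
  show ?case by (rule exI[of _ Falsum]) simp
next
  case (insert s S)
  then obtain B where "vars B \<subseteq> P" "\<forall>V x. fc V x B = (\<exists>s\<in>S. fc V x (f s))" by auto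
  then show ?case using insert.prems by (intro exI[of _ "Disj (f s) B"]) auto
qed

text \<open>If every \<open>y\<close> above \<open>x\<close> were separated from \<open>x'\<close>
  by some \<open>f y\<close>, let \<open>B\<close> conjoin those \<open>f y\<close> that hold at
  \<open>x'\<close> and let \<open>C\<close> disjoin those that fail there. A point above
  \<open>x\<close> forcing \<open>B\<close> forces its own \<open>f y\<close>, one of the disjuncts
  of \<open>C\<close>; so \<open>x\<close> forces \<open>Impl B C\<close>, which \<open>x'\<close>
  refutes.\<close>

lemma theory_inclusion:
  assumes incl: "\<And>B. vars B \<subseteq> {..<m} \<Longrightarrow> fc V x B \<Longrightarrow> fc V' x' B"
  shows "\<exists>y. le x y \<and> eqv m V y V' x'"
proof (rule ccontr)
  assume "\<not> ?thesis"
  then have "\<forall>y. \<exists>B. le x y \<longrightarrow> vars B \<subseteq> {..<m} \<and> fc V y B \<noteq> fc V' x' B"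
    by (auto simp: eqv_def)
  then obtain f where f: "\<And>y. le x y \<Longrightarrow> vars (f y) \<subseteq> {..<m} \<and> fc V y (f y) \<noteq> fc V' x' (f y)"
    by metis
  let ?P = "{y. le x y \<and> fc V' x' (f y)}" and ?Q = "{y. le x y \<and> \<not> fc V' x' (f y)}"
  have fin: "finite ?P" "finite ?Q"
    by (auto intro: finite_subset[OF _ finite_C5])
  obtain B where B: "vars B \<subseteq> {..<m}" "\<forall>V x. fc V x B = (\<forall>s\<in>?P. fc V x (f s))"
    using ex_big_Conj[OF fin(1), of f "{..<m}"] f by auto
  obtain C where C: "vars C \<subseteq> {..<m}" "\<forall>V x. fc V x C = (\<exists>s\<in>?Q. fc V x (f s))"
    using ex_big_Disj[OF fin(2), of f "{..<m}"] f by auto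
  have "fc V y C" if y: "le x y" "fc V y B" for y
  proof -
    have "\<not> fc V' x' (f y)" using B(2) f[OF y(1)] y by blast
    then show ?thesis using C(2) f[OF y(1)] y(1) by blast
  qed
  then have "fc V x (Impl B C)" by simp
  then have "fc V' x' (Impl B C)" using B C by (intro incl) auto
  then have "fc V' x' C" using B by auto
  then show False using C by auto
qed

text \<open>Theories grow upwards, so the theory of \<open>x'\<close> is included in that of
  \<open>y\<close>, and \<open>theory_inclusion\<close> applies from \<open>x'\<close>.\<close>

lemma eqv_forth:
  assumes "pers V" "eqv m V x V' x'" "le x y"
  shows "\<exists>y'. le x' y' \<and> eqv m V y V' y'"
proof -
  have "fc V y B" if "vars B \<subseteq> {..<m}" "fc V' x' B" for B
    using assms that by (auto simp: eqv_def intro: fc_mono)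
  then show ?thesis
    using theory_inclusion[of m V' x' V y] eqv_sym by blast
qed

lemma eqv_back:
  assumes "pers V'" "eqv m V x V' x'" "le x' y'"
  shows "\<exists>y. le x y \<and> eqv m V y V' y'"
  using eqv_forth[OF assms(1) eqv_sym[OF assms(2)] assms(3)] eqv_sym by blast

text \<open>Falsifying all variables from \<open>m\<close> on leaves finitely many models, which
  still test every formula in the first \<open>m\<close> variables.\<close>

definition truncv :: "nat \<Rightarrow> val \<Rightarrow> val" where
  "truncv m V = (\<lambda>x. trunc m (V x))"

definition models :: "nat \<Rightarrow> val set" where
  "models m = {V. pers V \<and> truncv m V = V}"

lemma truncv_models: "pers V \<Longrightarrow> truncv m V \<in> models m"
  by (auto simp: models_def truncv_def intro!: persI trunc_mono dest: persD)

lemma eqv_truncv: "eqv m V x (truncv m V) x"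
  by (rule eqv_bisim[where Z = "(=)"]) (auto simp: truncv_def)

lemma finite_models: "finite (models m)"
proof -
  have "models m \<subseteq> {V. \<forall>x. (x \<in> UNIV \<longrightarrow> V x \<in> {f. trunc m f = f}) \<and> (x \<notin> UNIV \<longrightarrow> V x = undefined)}"
    by (auto simp: models_def truncv_def fun_eq_iff)
  moreover have "finite \<dots>"
    by (rule finite_set_of_finite_funs[OF finite_C5 finite_labels])
  ultimately show ?thesis by (rule finite_subset)
qed

text \<open>A disjunctive normal form. By \<open>theory_inclusion\<close>, a point of
  \<open>S\<close> not separable from a point of \<open>N\<close> would have an equivalent of the
  latter above it, against upward closure and invariance of \<open>g\<close>. The formula is the
  disjunction over \<open>S\<close> of the conjunctions over \<open>N\<close> of the separating
  formulas.\<close>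

lemma definable:
  assumes inv: "\<And>V V' x x'. pers V \<Longrightarrow> pers V' \<Longrightarrow> eqv m V x V' x' \<Longrightarrow> g V x \<Longrightarrow> g V' x'"
    and mono: "\<And>V x y. pers V \<Longrightarrow> le x y \<Longrightarrow> g V x \<Longrightarrow> g V y"
  shows "\<exists>B. vars B \<subseteq> {..<m} \<and> (\<forall>V x. pers V \<longrightarrow> fc V x B = g V x)"
proof -
  define S where "S = {s \<in> models m \<times> UNIV. g (fst s) (snd s)}"
  define N where "N = {s \<in> models m \<times> UNIV. \<not> g (fst s) (snd s)}"
  have fin: "finite S" "finite N"
    unfolding S_def N_def using finite_models finite_C5 by auto
  define sep where "sep s s' B \<longleftrightarrow> vars B \<subseteq> {..<m} \<and> fc (fst s) (snd s) B \<and> \<not> fc (fst s') (snd s') B"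
    for s s' :: "val \<times> C5" and B
  have "\<exists>B. sep s s' B" if s: "s \<in> S" "s' \<in> N" for s s'
  proof (rule ccontr)
    assume "\<not> ?thesis"
    then obtain y where y: "le (snd s) y" "eqv m (fst s) y (fst s') (snd s')"
      using theory_inclusion[of m "fst s" "snd s" "fst s'" "snd s'"] unfolding sep_def by blast
    have p: "pers (fst s)" "pers (fst s')" "g (fst s) (snd s)" "\<not> g (fst s') (snd s')"
      using s by (auto simp: models_def S_def N_def)
    have "g (fst s) y" by (rule mono[OF p(1) y(1) p(3)])
    then have "g (fst s') (snd s')" by (rule inv[OF p(1,2) y(2)])
    then show False using p(4) by contradiction
  qed
  then obtain f where f: "\<And>s s'. s \<in> S \<Longrightarrow> s' \<in> N \<Longrightarrow> sep s s' (f s s')"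
    by metis
  have "\<exists>B. vars B \<subseteq> {..<m} \<and> (\<forall>V x. fc V x B = (\<forall>s'\<in>N. fc V x (f s s')))" if "s \<in> S" for s
    using ex_big_Conj[OF fin(2), of "f s" "{..<m}"] f[OF that] unfolding sep_def by blast
  then obtain h where h: "\<And>s. s \<in> S \<Longrightarrow> vars (h s) \<subseteq> {..<m}"
      "\<And>s V x. s \<in> S \<Longrightarrow> fc V x (h s) = (\<forall>s'\<in>N. fc V x (f s s'))"
    by metis
  obtain B where B: "vars B \<subseteq> {..<m}" "\<And>V x. fc V x B = (\<exists>s\<in>S. fc V x (h s))"
    using ex_big_Disj[OF fin(1), of h "{..<m}"] h(1) by blast
  have models: "fc V x B = g V x" if V: "V \<in> models m" for V x
  proof
    assume "g V x"
    then have s: "(V, x) \<in> S" using V by (simp add: S_def)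
    have "fc V x (h (V, x))"
      unfolding h(2)[OF s] using f[OF s] by (auto simp: sep_def)
    then show "fc V x B" unfolding B(2) using s by blast
  next
    assume "fc V x B"
    then obtain s where s: "s \<in> S" "fc V x (h s)" unfolding B(2) by blast
    show "g V x"
    proof (rule ccontr)
      assume "\<not> g V x"
      then have N: "(V, x) \<in> N" using V by (simp add: N_def)
      then have "fc V x (f s (V, x))" using h(2)[OF s(1)] s(2) by blast
      then show False using f[OF s(1) N] by (simp add: sep_def)
    qed
  qed
  have "fc V x B = g V x" if V: "pers V" for V x
  proof -
    have T: "truncv m V \<in> models m" "pers (truncv m V)" and e: "eqv m V x (truncv m V) x"
      using truncv_models[OF V] eqv_truncv by (auto simp: models_def)
    have "fc V x B = fc (truncv m V) x B"
      using e B(1) by (simp add: eqv_def)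
    also have "\<dots> = g (truncv m V) x" by (rule models[OF T(1)])
    also have "\<dots> = g V x"
      using inv[OF V T(2) e] inv[OF T(2) V eqv_sym[OF e]] by blast
    finally show ?thesis .
  qed
  then show ?thesis using B(1) by blast
qed

section \<open>Flat points, maximal points and forks\<close>

text \<open>An \<open>eqv\<close>-invariant substitute for maximality: a maximal point may be
  equivalent to one that is not maximal.\<close>

definition flat :: "nat \<Rightarrow> val \<Rightarrow> C5 \<Rightarrow> bool" where
  "flat m V x \<longleftrightarrow> (\<forall>y. le x y \<longrightarrow> trunc m (V y) = trunc m (V x))"

lemma flatD: "flat m V x \<Longrightarrow> le x y \<Longrightarrow> trunc m (V y) = trunc m (V x)"
  unfolding flat_def by blast

lemma flat_eqv:
  assumes "pers V'" "eqv m V x V' x'" "flat m V x"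
  shows "flat m V' x'"
  unfolding flat_def
proof (intro allI impI)
  fix y' assume y': "le x' y'"
  then obtain y where "le x y" "eqv m V y V' y'"
    using eqv_back[OF assms(1,2) y'] by blast
  then show "trunc m (V' y') = trunc m (V' x')"
    using flatD[OF assms(3)] eqv_label[OF assms(2)] eqv_label[of m V y V' y'] by simp
qed

lemma flat_mono: "flat m V x \<Longrightarrow> le x y \<Longrightarrow> flat m V y"
  unfolding flat_def by (metis le_trans)

definition maxi :: "C5 \<Rightarrow> bool" where
  "maxi x \<longleftrightarrow> x = C5_c \<or> x = C5_t \<or> x = C5_d"

lemma maxi_le: "maxi x \<Longrightarrow> le x y \<longleftrightarrow> y = x"
  by (auto simp: maxi_def C5_le_iff)

lemma maxi_flat: "maxi x \<Longrightarrow> flat m V x"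
  by (auto simp: flat_def maxi_le)

lemma ex_maxi: "\<exists>y. maxi y \<and> le x y"
  by (cases x) (auto simp: maxi_def C5_le_iff)

text \<open>Both orientations are listed, so that either end can be the distinguished one.\<close>

definition fork :: "C5 \<Rightarrow> C5 \<Rightarrow> C5 \<Rightarrow> bool" where
  "fork x y z \<longleftrightarrow> (x, y, z) \<in> {(C5_a, C5_c, C5_t), (C5_a, C5_t, C5_c), (C5_b, C5_t, C5_d), (C5_b, C5_d, C5_t)}"

lemma fork_le: "fork x y z \<Longrightarrow> le x q \<longleftrightarrow> q = x \<or> q = y \<or> q = z"
  and fork_maxi: "fork x y z \<Longrightarrow> maxi y \<and> maxi z \<and> \<not> maxi x \<and> x \<noteq> C5_r"
  and fork_sym: "fork x y z \<Longrightarrow> fork x z y"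
  by (auto simp: fork_def C5_le_iff maxi_def)

lemma maxi_eqv:
  assumes "maxi x" "maxi x'" "trunc m (V x) = trunc m (V' x')"
  shows "eqv m V x V' x'"
  using assms by (intro eqv_bisim[where Z = "\<lambda>q q'. q = x \<and> q' = x'"]) (auto simp: maxi_le)

lemma fork_eqv:
  assumes f: "fork x y z" "fork x' y' z'"
    and lab: "trunc m (V x) = trunc m (V' x')" "trunc m (V y) = trunc m (V' y')"
      "trunc m (V z) = trunc m (V' z')"
  shows "eqv m V x V' x'"
proof -
  define Z where "Z q q' \<longleftrightarrow> q = x \<and> q' = x' \<or> q = y \<and> q' = y' \<or> q = z \<and> q' = z'" for q q'
  have ZI: "Z x x'" "Z y y'" "Z z z'" by (auto simp: Z_def)
  have ZE: "Z q q' \<Longrightarrow> (q = x \<Longrightarrow> q' = x' \<Longrightarrow> P) \<Longrightarrow> (q = y \<Longrightarrow> q' = y' \<Longrightarrow> P) \<Longrightarrow>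
      (q = z \<Longrightarrow> q' = z' \<Longrightarrow> P) \<Longrightarrow> P" for q q' P
    unfolding Z_def by blast
  have up: "le x' y'" "le x' z'" "le x y" "le x z"
    using fork_le[OF f(1)] fork_le[OF f(2)] by simp_all
  have mx: "maxi y" "maxi z" "maxi y'" "maxi z'"
    using fork_maxi f by blast+
  show ?thesis
  proof (rule eqv_bisim[of Z])
    show "Z x x'" by (rule ZI)
    fix q q' p assume "Z q q'"
    then show "trunc m (V q) = trunc m (V' q')"
      by (rule ZE) (simp_all add: lab)
    show "\<exists>p'. le q' p' \<and> Z p p'" if "le q p"
      using \<open>Z q q'\<close>
    proof (rule ZE)
      assume "q = x" "q' = x'"
      then show ?thesis using that fork_le[OF f(1), of p] ZI up le_refl by metis
    qed (use that maxi_le mx ZI le_refl in metis)+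
    show "\<exists>p'. le q p' \<and> Z p' p" if "le q' p"
      using \<open>Z q q'\<close>
    proof (rule ZE)
      assume "q = x" "q' = x'"
      then show ?thesis using that fork_le[OF f(2), of p] ZI up le_refl by metis
    qed (use that maxi_le mx ZI le_refl in metis)+
  qed
qed

lemma C5_cases: "x = C5_r \<or> maxi x \<or> (\<exists>y z. fork x y z)"
  by (cases x) (auto simp: maxi_def fork_def)

text \<open>Keeping an admissible \<open>w\<close> is what lets \<open>G\<close> reproduce \<sigma>.
  The fallback depends on \<open>P\<close> alone, which keeps the construction invariant under
  \<open>eqv\<close>.\<close>

definition pick :: "('b \<Rightarrow> bool) \<Rightarrow> 'b \<Rightarrow> 'b" where
  "pick P w = (if P w then w else (SOME w. P w))"

lemma pick: "P w' \<Longrightarrow> P (pick P w)"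
  unfolding pick_def by (auto intro: someI)

section \<open>A more general unifier with a bounded number of variables\<close>

text \<open>Here \<open>N\<close> bounds the number of pairs of \<open>n\<close>-labels, enumerated
  by \<open>e\<close>. The number \<open>k\<close> depends on \<sigma>, whereas \<open>n + N\<close>
  can be chosen from \<open>A\<close> alone; this makes the bound uniform.\<close>

locale bounded_unifier =
  fixes n k N :: nat and \<sigma> :: subst and A :: form
    and e :: "nat \<Rightarrow> (nat \<Rightarrow> bool) \<times> (nat \<Rightarrow> bool)"
  assumes vars_A: "vars A \<subseteq> {..<n}"
    and vars_\<sigma>: "\<And>p. p < n \<Longrightarrow> vars (\<sigma> p) \<subseteq> {..<k}"
    and unif: "\<And>V x. pers V \<Longrightarrow> fc V x (subst_form \<sigma> A)"
    and e_surj: "{f. trunc n f = f} \<times> {f. trunc n f = f} \<subseteq> e ` {..<N}"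
begin

definition m :: nat where "m = n + N"

definition sg :: "val \<Rightarrow> val" where
  "sg V x = trunc n (\<lambda>p. fc V x (\<sigma> p))"

definition sgpt :: "(nat \<Rightarrow> bool) \<Rightarrow> nat \<Rightarrow> bool" where
  "sgpt v = sg (\<lambda>_. v) C5_c"

text \<open>
  The labels of the root and of the other end of those forks in the image of \<open>\<sigma>\<close> one of whose
  ends comes from the label \<open>v\<close>. Two forks with a common \<open>D\<close>-end can be glued to a model on \<open>C5\<close>.
\<close>

definition D :: "(nat \<Rightarrow> bool) \<Rightarrow> ((nat \<Rightarrow> bool) \<times> (nat \<Rightarrow> bool)) set" where
  "D v = {(sg V C5_a, sg V C5_t) |V. pers V \<and> trunc k (V C5_c) = trunc k v}"

text \<open>One extra variable per pair of \<open>n\<close>-labels stores membership in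
  \<open>D v\<close>, so a label in \<open>k\<close> variables is summarized in \<open>m\<close>
  variables however large \<open>k\<close> is.\<close>

definition code :: "(nat \<Rightarrow> bool) \<Rightarrow> nat \<Rightarrow> bool" where
  "code v = (\<lambda>p. if p < n then sgpt v p else e (p - n) \<in> D v)"

text \<open>Decoding. A label that is no code is still sent to some \<open>u\<close>, so every label
  is read as one at which \<sigma> can be evaluated.\<close>

definition star :: "(nat \<Rightarrow> bool) \<Rightarrow> nat \<Rightarrow> bool" where
  "star v = (SOME u. trunc m (code u) = trunc m v)"

text \<open>Stated with flat points to be invariant under \<open>eqv\<close>;
  \<open>ends_maxi\<close> brings back the maximal points.\<close>

definition ends :: "val \<Rightarrow> C5 \<Rightarrow> (nat \<Rightarrow> bool) set" where
  "ends V x = (\<lambda>y. star (V y)) ` {y. le x y \<and> flat m V y}"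

text \<open>The quantifiers cover both orders of a pair, and \<open>X = Y\<close> for a singleton.
  Three ends arise only at a root that is not \<open>low\<close>, where \<open>good2\<close> decides
  instead.\<close>

definition good1 :: "(nat \<Rightarrow> bool) set \<Rightarrow> (nat \<Rightarrow> bool) \<Rightarrow> bool" where
  "good1 S w \<longleftrightarrow> (\<forall>X Y. S = {X, Y} \<longrightarrow> (w, sgpt X) \<in> D Y)"

definition G1 :: "val \<Rightarrow> val" where
  "G1 V x = (if flat m V x then sgpt (star (V x)) else pick (good1 (ends V x)) (trunc n (V x)))"

definition low :: "val \<Rightarrow> C5 \<Rightarrow> bool" where
  "low V x \<longleftrightarrow> (\<exists>V' y. pers V' \<and> y \<noteq> C5_r \<and> eqv m V x V' y)"

definition good2 :: "val \<Rightarrow> (nat \<Rightarrow> bool) \<Rightarrow> bool" where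
  "good2 V w \<longleftrightarrow> fc ((G1 V)(C5_r := w)) C5_r A \<and> (\<forall>y. y \<noteq> C5_r \<longrightarrow> w \<le> G1 V y)"

text \<open>
  The semantic form of the bounded unifier. A label is changed only where it does not already
  yield a model of \<open>A\<close>. The root needs the test \<open>low\<close> because it may be equivalent to a point of
  depth at most two in some other model, which then already determines its label.
\<close>

definition G :: "val \<Rightarrow> val" where
  "G V x = (if low V x then G1 V x else pick (good2 V) (trunc n (V x)))"

lemma n_le_m: "n \<le> m"
  by (simp add: m_def)

lemma trunc_m_n: "trunc m f = trunc m g \<Longrightarrow> trunc n f = trunc n g"
  using n_le_m by (auto simp: trunc_eq_iff)

lemma trunc_sg [simp]: "trunc n (sg V x) = sg V x"
  by (simp add: sg_def)

lemma pers_sg: "pers V \<Longrightarrow> pers (sg V)"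
  unfolding sg_def by (rule persI, rule trunc_mono, rule persD[OF pers_fc])

lemma sg_eqv: "eqv k V x V' x' \<Longrightarrow> sg V x = sg V' x'"
  using vars_\<sigma> by (auto simp: eqv_def sg_def trunc_def fun_eq_iff)

lemma fc_sg_A:
  assumes "pers V"
  shows "fc (sg V) x A"
proof -
  have "fc (sg V) x A = fc (\<lambda>y p. fc V y (\<sigma> p)) x A"
    using vars_A by (intro fc_bisim[where Z = "(=)" and P = "{..<n}"]) (auto simp: sg_def trunc_def)
  then show ?thesis using unif[OF assms] by (simp add: fc_subst)
qed

lemma sg_maxi: "maxi y \<Longrightarrow> trunc k (V y) = trunc k v \<Longrightarrow> sg V y = sgpt v"
  unfolding sgpt_def by (intro sg_eqv maxi_eqv) (auto simp: maxi_def)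

lemma sgpt_cong: "trunc k v = trunc k v' \<Longrightarrow> sgpt v = sgpt v'"
  using sg_maxi[of C5_c "\<lambda>_. v" v'] by (simp add: maxi_def sgpt_def)

lemma D_cong: "trunc k v = trunc k v' \<Longrightarrow> D v = D v'"
  by (simp add: D_def)

lemma D_fork:
  assumes "pers V" "fork x y z"
  shows "(sg V x, sgpt (V z)) \<in> D (V y)"
proof -
  \<comment> \<open>The fork is copied to \<open>C5_a\<close> with its distinguished end at
    \<open>C5_c\<close>; the other points repeat labels so as to stay persistent.\<close>
  let ?V = "\<lambda>q. if q = C5_c then V y else if q = C5_t \<or> q = C5_d then V z else V x"
  have xy: "V x \<le> V y" "V x \<le> V z"
    using persD[OF assms(1), of x] fork_le[OF assms(2)] by simp_all
  have "pers ?V"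
  proof (rule persI)
    fix q q' assume "le q q'"
    then show "?V q \<le> ?V q'"
      using xy by (cases q; cases q') (simp_all add: C5_le_iff)
  qed
  moreover have "sg ?V C5_a = sg V x"
    by (rule sg_eqv, rule fork_eqv[OF _ assms(2), of _ C5_c C5_t]) (simp_all add: fork_def)
  moreover have "sg ?V C5_t = sgpt (V z)"
    by (rule sg_maxi) (auto simp: maxi_def)
  ultimately show ?thesis
    unfolding D_def by (auto intro!: exI[of _ ?V])
qed

text \<open>Obtained from the constant model. It covers forks at flat points and shows that no
  \<open>D v\<close> is empty.\<close>

lemma D_const: "(sgpt v, sgpt v) \<in> D v"
proof -
  have "pers (\<lambda>_. v)" by (auto intro: persI)
  from D_fork[OF this, of C5_a C5_c C5_t] show ?thesis
    by (simp add: fork_def sgpt_def)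
       (metis (no_types, lifting) sg_eqv eqv_bisim[where Z = "\<lambda>_ _. True"] le_refl)
qed

lemma D_subset: "D v \<subseteq> e ` {..<N}"
proof -
  have "D v \<subseteq> {f. trunc n f = f} \<times> {f. trunc n f = f}"
    by (auto simp: D_def)
  then show ?thesis using e_surj by blast
qed

lemma DE:
  assumes "(w, u) \<in> D v"
  obtains V where "pers V" "trunc k (V C5_c) = trunc k v" "sg V C5_a = w" "sg V C5_t = u"
    "sg V C5_c = sgpt v"
  using assms that unfolding D_def by (force intro: sg_maxi simp: maxi_def)

lemma ex_good1: "\<exists>w. good1 S w"
proof (cases "\<exists>X Y. S = {X, Y}")
  case True
  then obtain X Y where S: "S = {X, Y}" by blast
  \<comment> \<open>The fork at \<open>C5_a\<close> with ends \<open>X\<close> and \<open>Y\<close>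
    and their meet as root label.\<close>
  let ?V = "\<lambda>q. if q = C5_c then X else if q = C5_t then Y else (\<lambda>p. X p \<and> Y p \<and> q = C5_a)"
  have V: "pers ?V"
    by (rule persI) (auto simp: C5_le_iff le_fun_def)
  have "(sg ?V C5_a, sgpt Y) \<in> D X" "(sg ?V C5_a, sgpt X) \<in> D Y"
    using D_fork[OF V, of C5_a C5_c C5_t] D_fork[OF V, of C5_a C5_t C5_c] by (auto simp: fork_def)
  then have "good1 S (sg ?V C5_a)"
    unfolding good1_def S by (auto simp: doubleton_eq_iff)
  then show ?thesis by blast
qed (auto simp: good1_def)

section \<open>Decoding labels, and the map \<open>G1\<close> away from the root\<close>

lemma star_cong: "trunc m v = trunc m v' \<Longrightarrow> star v = star v'"
  by (simp add: star_def)

text \<open>The first \<open>n\<close> bits of a code determine \<open>sgpt\<close>, and the other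
  \<open>N\<close> determine \<open>D\<close>, since \<open>e\<close> enumerates all pairs that can
  occur in it.\<close>

lemma star_code:
  assumes "trunc m v = trunc m (code u)"
  shows "sgpt (star v) = sgpt u" "D (star v) = D u"
proof -
  let ?s = "star v"
  have "trunc m (code ?s) = trunc m v"
    unfolding star_def by (rule someI[where P = "\<lambda>u. trunc m (code u) = trunc m v", OF assms[symmetric]])
  then have eq: "trunc m (code ?s) = trunc m (code u)" using assms by simp
  have "trunc n (sgpt ?s) = trunc n (sgpt u)"
    using trunc_m_n[OF eq] by (auto simp: trunc_eq_iff code_def)
  then show "sgpt (star v) = sgpt u" by (simp add: sgpt_def)
  have "e j \<in> D ?s \<longleftrightarrow> e j \<in> D u" if "j < N" for j
    using eq[unfolded trunc_eq_iff, rule_format, of "n + j"] that by (simp add: code_def m_def)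
  then show "D (star v) = D u"
    using D_subset[of ?s] D_subset[of u] by auto
qed

text \<open>Above a flat point there is a maximal one with the same \<open>m\<close>-label.\<close>

lemma ends_maxi: "ends V x = (\<lambda>y. star (V y)) ` {y. le x y \<and> maxi y}"
proof (intro equalityI subsetI)
  fix s assume "s \<in> ends V x"
  then obtain y where y: "s = star (V y)" "le x y" "flat m V y"
    unfolding ends_def by (elim imageE) simp
  obtain z where z: "maxi z" "le y z" using ex_maxi by blast
  have "star (V y) = star (V z)"
    by (rule star_cong[OF flatD[OF y(3) z(2), symmetric]])
  then show "s \<in> (\<lambda>y. star (V y)) ` {y. le x y \<and> maxi y}"
    using y(1) z(1) le_trans[OF y(2) z(2)] by (intro image_eqI[of _ _ z]) simp_all
next
  fix s assume "s \<in> (\<lambda>y. star (V y)) ` {y. le x y \<and> maxi y}"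
  then show "s \<in> ends V x"
    unfolding ends_def by (elim imageE) (simp add: maxi_flat)
qed

lemma ends_fork:
  assumes "fork x y z"
  shows "ends V x = {star (V y), star (V z)}"
proof -
  have "{q. le x q \<and> maxi q} = {y, z}"
    using fork_maxi[OF assms] fork_le[OF assms] by auto
  then show ?thesis
    unfolding ends_maxi by simp
qed

lemma ends_eqv:
  assumes "pers V" "pers V'" "eqv m V x V' x'"
  shows "ends V x = ends V' x'"
proof -
  have *: "ends V x \<subseteq> ends V' x'" if h: "pers V" "pers V'" "eqv m V x V' x'" for V V' x x'
  proof
    fix s assume "s \<in> ends V x"
    then obtain y where y: "s = star (V y)" "le x y" "flat m V y"
      unfolding ends_def by (elim imageE) simp
    obtain y' where y': "le x' y'" "eqv m V y V' y'" using eqv_forth[OF h(1,3) y(2)] by blast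
    have "star (V y) = star (V' y')"
      by (rule star_cong[OF eqv_label[OF y'(2)]])
    moreover have "flat m V' y'"
      by (rule flat_eqv[OF h(2) y'(2) y(3)])
    ultimately show "s \<in> ends V' x'" using y(1) y'(1) unfolding ends_def by (intro image_eqI[of _ _ y']) simp_all
  qed
  show ?thesis using *[OF assms] *[OF assms(2,1) eqv_sym[OF assms(3)]] by blast
qed

lemma G1_eqv:
  assumes "pers V" "pers V'" "eqv m V x V' x'"
  shows "G1 V x = G1 V' x'"
proof -
  have "flat m V x = flat m V' x'"
    using flat_eqv[OF assms(2,3)] flat_eqv[OF assms(1) eqv_sym[OF assms(3)]] by blast
  moreover have "trunc n (V x) = trunc n (V' x')" "star (V x) = star (V' x')"
    by (rule trunc_m_n[OF eqv_label[OF assms(3)]], rule star_cong[OF eqv_label[OF assms(3)]])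
  ultimately show ?thesis
    using ends_eqv[OF assms] by (simp add: G1_def)
qed

lemma G1_maxi: "maxi x \<Longrightarrow> G1 V x = sgpt (star (V x))"
  by (simp add: G1_def maxi_flat)

text \<open>The invariant behind gluing: every fork of \<open>G1 V\<close> is recorded at its end.
  Flat forks are constant, and elsewhere \<open>pick\<close> has enforced
  \<open>good1\<close>.\<close>

lemma G1_fork:
  assumes "fork x y z"
  shows "(G1 V x, G1 V z) \<in> D (star (V y))"
proof (cases "flat m V x")
  case True
  then have "trunc m (V y) = trunc m (V x)" "trunc m (V z) = trunc m (V x)"
    using flatD[OF True] fork_le[OF assms] by blast+
  then have "star (V y) = star (V x)" "star (V z) = star (V x)"
    using star_cong by blast+
  then show ?thesis
    using True D_const[of "star (V x)"] G1_maxi[of z V] fork_maxi[OF assms] by (simp add: G1_def[of V x])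
next
  case False
  obtain w where "good1 (ends V x) w" using ex_good1 by blast
  then have "good1 (ends V x) (G1 V x)"
    unfolding G1_def using False by (simp add: pick)
  moreover have "ends V x = {star (V z), star (V y)}"
    using ends_fork[OF assms] by (simp add: insert_commute)
  ultimately have "(G1 V x, sgpt (star (V z))) \<in> D (star (V y))"
    unfolding good1_def by blast
  then show ?thesis
    using fork_maxi[OF assms] G1_maxi[of z V] by simp
qed

text \<open>Realizes a fork of \<open>G1 V\<close> as a \<sigma>-image whose source has a prescribed
  \<open>k\<close>-label at the distinguished end.\<close>

lemma G1_forkE:
  assumes "fork x y z"
  obtains W where "pers W" "trunc k (W C5_c) = trunc k (star (V y))" "sg W C5_a = G1 V x"
    "sg W C5_t = G1 V z" "sg W C5_c = G1 V y"
proof (rule DE[OF G1_fork[OF assms, of V]])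
  fix W assume "pers W" "trunc k (W C5_c) = trunc k (star (V y))" "sg W C5_a = G1 V x"
    "sg W C5_t = G1 V z" "sg W C5_c = sgpt (star (V y))"
  moreover have "G1 V y = sgpt (star (V y))"
    using G1_maxi fork_maxi[OF assms] by blast
  ultimately show ?thesis using that by simp
qed

text \<open>Maximal points and forks of \<open>G1 V\<close> look like points of \<sigma>-images,
  which force \<open>A\<close> because \<sigma> is a unifier.\<close>

lemma G1_model:
  assumes "x \<noteq> C5_r"
  shows "fc (G1 V) x A \<and> (\<forall>y. le x y \<longrightarrow> G1 V x \<le> G1 V y)"
proof -
  consider "maxi x" | y z where "fork x y z"
    using C5_cases[of x] assms by blast
  then show ?thesis
  proof cases
    case 1
    let ?W = "\<lambda>_. star (V x)"
    have "eqv n (G1 V) x (sg ?W) C5_c"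
      using G1_maxi[OF 1, of V] 1 by (intro maxi_eqv) (simp_all add: sgpt_def maxi_def)
    then have "fc (G1 V) x A \<longleftrightarrow> fc (sg ?W) C5_c A"
      using vars_A by (simp add: eqv_def)
    moreover have "pers ?W" by (auto intro: persI)
    ultimately show ?thesis using fc_sg_A[of ?W] 1 by (auto simp: maxi_le)
  next
    case 2
    obtain W where W: "pers W" "sg W C5_a = G1 V x" "sg W C5_t = G1 V z" "sg W C5_c = G1 V y"
      using G1_forkE[OF 2, of V] .
    have "eqv n (G1 V) x (sg W) C5_a"
      using W(2-4) by (intro fork_eqv[OF 2, of _ C5_c C5_t]) (simp_all add: fork_def)
    then have "fc (G1 V) x A"
      using fc_sg_A[OF W(1), of C5_a] vars_A by (simp add: eqv_def)
    moreover have "G1 V x \<le> G1 V y" "G1 V x \<le> G1 V z"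
      unfolding W(2-4)[symmetric] by (rule persD[OF pers_sg[OF W(1)]], simp add: C5_le_iff)+
    ultimately show ?thesis using fork_le[OF 2] by (metis order_refl)
  qed
qed

text \<open>Gluing two forks along their common end.\<close>

lemma ex_good2: "\<exists>w. good2 V w"
proof -
  \<comment> \<open>Both forks are oriented towards their shared end \<open>C5_t\<close>.\<close>
  have f: "fork C5_a C5_t C5_c" "fork C5_b C5_t C5_d" by (auto simp: fork_def)
  obtain V1 where V1: "pers V1"
      "trunc k (V1 C5_c) = trunc k (star (V C5_t))" "sg V1 C5_a = G1 V C5_a"
      "sg V1 C5_t = G1 V C5_c" "sg V1 C5_c = G1 V C5_t"
    using G1_forkE[OF f(1), of V] .
  obtain V2 where V2: "pers V2"
      "trunc k (V2 C5_c) = trunc k (star (V C5_t))" "sg V2 C5_a = G1 V C5_b"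
      "sg V2 C5_t = G1 V C5_d" "sg V2 C5_c = G1 V C5_t"
    using G1_forkE[OF f(2), of V] .
  \<comment> \<open>\<open>C5_c\<close> of either source becomes \<open>C5_t\<close>. The sources
    agree there only on the first \<open>k\<close> variables, hence the truncation.\<close>
  let ?W = "\<lambda>q. trunc k (case q of C5_r \<Rightarrow> (\<lambda>_. False) | C5_a \<Rightarrow> V1 C5_a | C5_c \<Rightarrow> V1 C5_t
      | C5_t \<Rightarrow> V1 C5_c | C5_b \<Rightarrow> V2 C5_a | C5_d \<Rightarrow> V2 C5_t)"
  have ct: "trunc k (V1 C5_c) = trunc k (V2 C5_c)" using V1 V2 by simp
  have le1: "V1 C5_a \<le> V1 C5_c" "V1 C5_a \<le> V1 C5_t" "V2 C5_a \<le> V2 C5_c" "V2 C5_a \<le> V2 C5_t"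
    by (rule persD[OF V1(1)] persD[OF V2(1)], simp add: C5_le_iff)+
  have W: "pers ?W"
  proof (rule persI)
    fix x y assume "le x y"
    moreover have "trunc k (\<lambda>_. False) \<le> f" for f by (auto simp: trunc_def le_fun_def)
    ultimately show "?W x \<le> ?W y"
      using trunc_mono[OF le1(1), of k] trunc_mono[OF le1(2), of k] trunc_mono[OF le1(3), of k]
        trunc_mono[OF le1(4), of k] ct
      by (cases x; cases y) (simp_all add: C5_le_iff)
  qed
  have a: "sg ?W C5_a = G1 V C5_a"
    unfolding V1(3)[symmetric]
    by (rule sg_eqv, rule fork_eqv[of _ C5_t C5_c _ C5_c C5_t]) (simp_all add: fork_def)
  have b: "sg ?W C5_b = G1 V C5_b"
    unfolding V2(3)[symmetric]
    by (rule sg_eqv, rule fork_eqv[of _ C5_t C5_d _ C5_c C5_t]) (simp_all add: fork_def ct)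
  have c: "sg ?W C5_c = G1 V C5_c"
    unfolding V1(4)[symmetric] by (intro sg_eqv maxi_eqv) (simp_all add: maxi_def)
  have t: "sg ?W C5_t = G1 V C5_t"
    unfolding V1(5)[symmetric] by (intro sg_eqv maxi_eqv) (simp_all add: maxi_def)
  have d: "sg ?W C5_d = G1 V C5_d"
    unfolding V2(4)[symmetric] by (intro sg_eqv maxi_eqv) (simp_all add: maxi_def)
  have eq: "sg ?W y = G1 V y" if "y \<noteq> C5_r" for y
    using that a b c t d by (cases y) simp_all
  have "(G1 V)(C5_r := sg ?W C5_r) = sg ?W"
    using eq by auto
  moreover have "sg ?W C5_r \<le> G1 V y" if "y \<noteq> C5_r" for y
    using persD[OF pers_sg[OF W], of C5_r y] eq[OF that] by simp
  ultimately have "good2 V (sg ?W C5_r)"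
    unfolding good2_def using fc_sg_A[OF W] by simp
  then show ?thesis by blast
qed

section \<open>The root and the full map \<open>G\<close>\<close>

lemma low_not_r: "pers V \<Longrightarrow> x \<noteq> C5_r \<Longrightarrow> low V x"
  unfolding low_def using eqv_refl by blast

lemma low_eqv: "eqv m V x V' x' \<Longrightarrow> low V x \<longleftrightarrow> low V' x'"
  unfolding low_def using eqv_sym eqv_trans by metis

text \<open>As these roots are not \<open>low\<close>, \<open>eqv\<close> relates a root only to a
  root. It therefore remains a bisimulation after both root labels are replaced by
  \<open>w\<close>.\<close>

lemma good2_eqv:
  assumes V: "pers V" "pers V'" and eq: "eqv m V C5_r V' C5_r" and low: "\<not> low V C5_r"
  shows "good2 V = good2 V'"
proof
  fix w
  let ?U = "(G1 V)(C5_r := w)" and ?U' = "(G1 V')(C5_r := w)"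
  have r: "y = C5_r \<longleftrightarrow> y' = C5_r" if "eqv m V y V' y'" for y y'
    using that low_eqv[OF that] low_eqv[OF eq] low low_not_r V by metis
  have lab: "?U y = ?U' y'" if "eqv m V y V' y'" for y y'
    using r[OF that] G1_eqv[OF V that] by auto
  have "fc ?U C5_r A = fc ?U' C5_r A"
    using lab eqv_forth[OF V(1)] eqv_back[OF V(2)]
    by (intro fc_bisim[where Z = "\<lambda>y y'. eqv m V y V' y'" and P = UNIV, OF eq]) auto
  moreover have "(\<forall>y. y \<noteq> C5_r \<longrightarrow> w \<le> G1 V y) \<longleftrightarrow> (\<forall>y. y \<noteq> C5_r \<longrightarrow> w \<le> G1 V' y)"
    using eqv_forth[OF V(1) eq] eqv_back[OF V(2) eq] r G1_eqv[OF V] by (metis le_r)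
  ultimately show "good2 V w = good2 V' w"
    by (simp add: good2_def)
qed

lemma G_not_r: "pers V \<Longrightarrow> x \<noteq> C5_r \<Longrightarrow> G V x = G1 V x"
  by (simp add: G_def low_not_r)

lemma G_eqv:
  assumes "pers V" "pers V'" "eqv m V x V' x'"
  shows "G V x = G V' x'"
proof (cases "low V x")
  case True
  then show ?thesis
    using low_eqv[OF assms(3)] G1_eqv[OF assms] by (simp add: G_def)
next
  case False
  moreover have "x = C5_r" "x' = C5_r"
    using False low_eqv[OF assms(3)] low_not_r assms by blast+
  ultimately show ?thesis
    using low_eqv[OF assms(3)] good2_eqv assms trunc_m_n[OF eqv_label[OF assms(3)]]
    by (simp add: G_def)
qed

lemma G_model_not_r:
  assumes V: "pers V" and x: "x \<noteq> C5_r"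
  shows "fc (G V) x A" "le x y \<Longrightarrow> G V x \<le> G V y"
proof -
  have nr: "q \<noteq> C5_r" if "le x q" for q
    using x that by (auto simp: C5_le_iff)
  have "fc (G V) x A \<longleftrightarrow> fc (G1 V) x A"
    using nr V
    by (intro fc_bisim[where Z = "\<lambda>q q'. q = q' \<and> le x q" and P = UNIV])
       (auto simp: G_not_r intro: le_trans)
  then show "fc (G V) x A" using G1_model[OF x] by blast
  show "le x y \<Longrightarrow> G V x \<le> G V y"
    using G1_model[OF x, of V] nr G_not_r[OF V] x by auto
qed

text \<open>At a \<open>low\<close> point the claim is transferred along \<open>eqv\<close> from a
  point other than the root. At any other root \<open>ex_good2\<close> ensures that
  \<open>pick\<close> returns an admissible label.\<close>

lemma G_model:
  assumes V: "pers V"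
  shows "fc (G V) x A \<and> (\<forall>y. le x y \<longrightarrow> G V x \<le> G V y)"
proof (cases "low V x")
  case True
  then obtain V' y where y: "pers V'" "y \<noteq> C5_r" "eqv m V x V' y"
    by (auto simp: low_def)
  have "fc (G V) x A \<longleftrightarrow> fc (G V') y A"
  proof (rule fc_bisim[where Z = "\<lambda>q q'. eqv m V q V' q'" and P = UNIV, OF y(3)])
    show "G V q p = G V' q' p" if "eqv m V q V' q'" for q q' p
      using G_eqv[OF V y(1) that] by simp
    show "\<exists>z'. le q' z' \<and> eqv m V z V' z'" if "eqv m V q V' q'" "le q z" for q q' z
      by (rule eqv_forth[OF V that])
    show "\<exists>z. le q z \<and> eqv m V z V' z'" if "eqv m V q V' q'" "le q' z'" for q q' z'
      by (rule eqv_back[OF y(1) that])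
  qed simp
  moreover have "G V x \<le> G V z" if z: "le x z" for z
  proof -
    obtain z' where z': "le y z'" "eqv m V z V' z'" using eqv_forth[OF V y(3) z] by blast
    show ?thesis
      using G_model_not_r(2)[OF y(1,2) z'(1)]
      unfolding G_eqv[OF V y(1) y(3)] G_eqv[OF V y(1) z'(2)] .
  qed
  ultimately show ?thesis using G_model_not_r(1)[OF y(1,2)] by blast
next
  case False
  then have x: "x = C5_r" using low_not_r[OF V] by blast
  obtain w where "good2 V w" using ex_good2 by blast
  then have good: "good2 V (G V C5_r)"
    unfolding G_def using False x by (simp add: pick)
  have "(G1 V)(C5_r := G V C5_r) = G V"
    using G_not_r[OF V] by (simp add: fun_eq_iff)
  then have "fc (G V) C5_r A"
    using good by (simp add: good2_def)
  moreover have "G V C5_r \<le> G V y" for y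
    using good G_not_r[OF V, of y] by (cases "y = C5_r") (simp_all add: good2_def)
  ultimately show ?thesis using x by blast
qed

lemma pers_G: "pers V \<Longrightarrow> pers (G V)"
  by (rule persI) (blast dest: G_model)

section \<open>Recovering \<sigma> from the bounded unifier\<close>

text \<open>
  The additional bits of \<open>\<alpha>\<close> hold only at flat points, so that \<open>\<alpha>\<close> does not make further points
  flat: otherwise a root could be mistaken for a fork with a label that no fork admits.
\<close>

lemma ex_\<alpha>:
  "\<exists>\<alpha>. (\<forall>p<n. \<alpha> p = \<sigma> p) \<and>
     (\<forall>p V x. n \<le> p \<longrightarrow> pers V \<longrightarrow> fc V x (\<alpha> p) = (flat k V x \<and> e (p - n) \<in> D (V x)))"
proof -
  have "\<exists>B. vars B \<subseteq> {..<k} \<and> (\<forall>V x. pers V \<longrightarrow> fc V x B = (flat k V x \<and> q \<in> D (V x)))" for q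
  proof (rule definable)
    fix V V' x x' assume h: "pers V" "pers V'" "eqv k V x V' x'" "flat k V x \<and> q \<in> D (V x)"
    then show "flat k V' x' \<and> q \<in> D (V' x')"
      using flat_eqv D_cong[OF eqv_label[OF h(3)]] by blast
  next
    fix V x y assume "pers V" "le x y" "flat k V x \<and> q \<in> D (V x)"
    then show "flat k V y \<and> q \<in> D (V y)"
      using flat_mono D_cong[of "V y" "V x"] flatD[of k V x y] by auto
  qed
  then obtain \<beta> where \<beta>: "\<And>q V x. pers V \<Longrightarrow> fc V x (\<beta> q) = (flat k V x \<and> q \<in> D (V x))"
    by metis
  show ?thesis
    by (rule exI[of _ "\<lambda>p. if p < n then \<sigma> p else \<beta> (e (p - n))"]) (simp add: \<beta>)
qed

text \<open>On an \<alpha>-image the codes are genuine, so the labels given by \<sigma> pass the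
  tests \<open>good1\<close> and \<open>good2\<close> where these apply, and \<open>pick\<close>
  keeps them.\<close>

lemma G_\<alpha>:
  assumes \<alpha>: "\<And>p. p < n \<Longrightarrow> \<alpha> p = \<sigma> p"
      "\<And>p V x. n \<le> p \<Longrightarrow> pers V \<Longrightarrow> fc V x (\<alpha> p) = (flat k V x \<and> e (p - n) \<in> D (V x))"
    and V: "pers V"
  shows "G (\<lambda>x p. fc V x (\<alpha> p)) = sg V"
proof
  define U where "U = (\<lambda>x p. fc V x (\<alpha> p))"
  have U: "pers U" unfolding U_def by (rule pers_fc[OF V])
  have lab: "trunc n (U x) = sg V x" for x
    using \<alpha>(1) by (auto simp: U_def sg_def trunc_def)
  have sgeq: "sg V x = sg V y" if "trunc m (U x) = trunc m (U y)" for x y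
    using trunc_m_n[OF that] lab by metis
  \<comment> \<open>Maximal points are flat, so the flatness condition in \<alpha> is met and the
    extra bits give exactly \<open>D (V y)\<close>.\<close>
  have code: "trunc m (U y) = trunc m (code (V y))" if y: "maxi y" for y
  proof -
    have "U y p = code (V y) p" for p
    proof (cases "p < n")
      case True
      then have "U y p = sg V y p" using lab[of y] by (auto simp: trunc_def fun_eq_iff)
      then show ?thesis using True sg_maxi[OF y, of V "V y"] by (simp add: code_def)
    next
      case False
      then show ?thesis
        using \<alpha>(2)[of p V y] V maxi_flat[OF y] by (simp add: U_def code_def)
    qed
    then show ?thesis by (simp add: trunc_def)
  qed
  note sc = star_code[OF code]
  have g_maxi: "G1 U y = sg V y" if y: "maxi y" for y
    using sc(1)[OF y] G1_maxi[OF y] sg_maxi[OF y, of V "V y"] by simp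
  have g_flat: "G1 U x = sg V x" if "flat m U x" for x
  proof -
    obtain y where y: "maxi y" "le x y" using ex_maxi by blast
    have eq: "trunc m (U y) = trunc m (U x)" by (rule flatD[OF that y(2)])
    then have "sg V y = sg V x" "star (U y) = star (U x)"
      by (rule sgeq, intro star_cong eq)
    then show ?thesis
      using g_maxi[OF y(1)] G1_maxi[OF y(1)] that by (simp add: G1_def)
  qed
  have g_good: "G1 U x = sg V x" if "good1 (ends U x) (sg V x)" for x
    using that g_flat[of x] lab[of x] by (auto simp: G1_def pick_def)
  have g_fork: "G1 U x = sg V x" if f: "fork x y z" for x y z
  proof (rule g_good)
    have "(sg V x, sgpt (V z)) \<in> D (V y)" "(sg V x, sgpt (V y)) \<in> D (V z)"
      using D_fork V f fork_sym by blast+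
    then show "good1 (ends U x) (sg V x)"
      using sc[of y] sc[of z] fork_maxi[OF f]
      unfolding ends_fork[OF f] good1_def by (auto simp: doubleton_eq_iff)
  qed
  have g1: "G1 U x = sg V x" if "x \<noteq> C5_r" for x
    using C5_cases[of x] that g_maxi g_fork by blast
  \<comment> \<open>A maximal point above \<open>x\<close> has a true extra bit, as \<open>D\<close>
    is nonempty there, while all extra bits are false at \<open>x\<close>.\<close>
  have not_flat: "\<not> flat m U x" if "\<not> flat k V x" for x
  proof
    assume fl: "flat m U x"
    obtain y where y: "maxi y" "le x y" using ex_maxi by blast
    obtain j where j: "j < N" "e j \<in> D (V y)"
      using D_const[of "V y"] D_subset[of "V y"] by (metis (no_types, opaque_lifting) imageE lessThan_iff subsetD)
    have "U y (n + j) = U x (n + j)"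
      using flatD[OF fl y(2)] j(1) by (simp add: trunc_eq_iff m_def)
    then show False
      using \<alpha>(2)[of "n + j" V] V j that maxi_flat[OF y(1)] by (auto simp: U_def)
  qed
  \<comment> \<open>Either all points above the root share one \<open>k\<close>-label, and the root
    looks like a fork with equal ends, or a point that is not flat forces the root to be equivalent
    to it.\<close>
  have g_low: "G1 U C5_r = sg V C5_r" if lowU: "low U C5_r"
  proof (cases "flat k V C5_a \<and> flat k V C5_b")
    case True
    have eq: "trunc k (V y) = trunc k (V C5_c)" if "y \<noteq> C5_r" for y
    proof -
      have "trunc k (V C5_c) = trunc k (V C5_a)" "trunc k (V C5_t) = trunc k (V C5_a)"
        "trunc k (V C5_t) = trunc k (V C5_b)" "trunc k (V C5_d) = trunc k (V C5_b)"
        by (rule flatD[OF conjunct1[OF True]] flatD[OF conjunct2[OF True]], simp add: C5_le_iff)+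
      then have "trunc k (V C5_a) = trunc k (V C5_c)" "trunc k (V C5_t) = trunc k (V C5_c)"
        "trunc k (V C5_b) = trunc k (V C5_c)" "trunc k (V C5_d) = trunc k (V C5_c)"
        by metis+
      then show ?thesis using that by (cases y) simp_all
    qed
    have st: "star (U y) = star (U C5_c)" if y: "maxi y" for y
    proof (rule star_cong)
      have "trunc k (V y) = trunc k (V C5_c)" using y by (intro eq) (auto simp: maxi_def)
      then have "code (V y) = code (V C5_c)"
        unfolding code_def using sgpt_cong D_cong by metis
      then show "trunc m (U y) = trunc m (U C5_c)"
        using code[OF y] code[of C5_c] by (simp add: maxi_def)
    qed
    have "ends U C5_r = {star (U C5_c), star (U C5_t), star (U C5_d)}"
    proof -
      have "{y. le C5_r y \<and> maxi y} = {C5_c, C5_t, C5_d}" by (auto simp: maxi_def)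
      then show ?thesis unfolding ends_maxi by simp
    qed
    then have ends: "ends U C5_r = {star (U C5_c)}"
      using st[of C5_t] st[of C5_d] by (simp add: maxi_def)
    \<comment> \<open>\<open>C5_a\<close> now carries a fork with equal ends that is bisimilar, on
      the first \<open>k\<close> variables, to the root of \<open>V\<close>.\<close>
    let ?W = "\<lambda>q. if q = C5_r \<or> q = C5_a \<or> q = C5_b then V C5_r else V C5_c"
    have W: "pers ?W"
    proof (rule persI)
      fix x y assume "le x y"
      then show "?W x \<le> ?W y"
        using persD[OF V, of C5_r C5_c] by (cases x; cases y) (simp_all add: C5_le_iff)
    qed
    have "eqv k ?W C5_a V C5_r"
    proof (rule eqv_bisim[where Z = "\<lambda>q q'. q = C5_a \<and> q' = C5_r \<or> maxi q \<and> q' \<noteq> C5_r"])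
      fix q q' z assume Z: "q = C5_a \<and> q' = C5_r \<or> maxi q \<and> q' \<noteq> C5_r"
      show "trunc k (?W q) = trunc k (V q')"
        using Z eq[of q'] by (auto simp: maxi_def)
      show "\<exists>z'. le q' z' \<and> (z = C5_a \<and> z' = C5_r \<or> maxi z \<and> z' \<noteq> C5_r)" if "le q z"
        using Z that by (auto simp: maxi_le C5_le_iff maxi_def)
      show "\<exists>z'. le q z' \<and> (z' = C5_a \<and> z = C5_r \<or> maxi z' \<and> z \<noteq> C5_r)" if "le q' z"
        using Z that by (auto simp: maxi_le C5_le_iff maxi_def)
    qed simp
    then have "sg ?W C5_a = sg V C5_r" by (rule sg_eqv)
    then have "(sg V C5_r, sgpt (V C5_c)) \<in> D (V C5_c)"
      using D_fork[OF W, of C5_a C5_c C5_t] by (simp add: fork_def)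
    then have "good1 (ends U C5_r) (sg V C5_r)"
      using sc[of C5_c] unfolding ends good1_def by (auto simp: maxi_def)
    then show ?thesis by (rule g_good)
  next
    case False
    then obtain x where x: "\<not> flat k V x" "x \<noteq> C5_r" by auto
    obtain V' y where y: "pers V'" "y \<noteq> C5_r" "eqv m U C5_r V' y"
      using lowU unfolding low_def by blast
    obtain y' where y': "le y y'" "eqv m U x V' y'"
      using eqv_forth[OF U y(3), of x] by auto
    \<comment> \<open>Hence \<open>y'\<close> is not maximal; since \<open>y\<close> is not the
      root, \<open>y'\<close> must be \<open>y\<close> itself.\<close>
    have "\<not> flat m V' y'"
      using not_flat[OF x(1)] flat_eqv[OF U eqv_sym[OF y'(2)]] by blast
    then have "\<not> maxi y'" using maxi_flat by blast
    then have "y' = y"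
      using y y'(1) by (auto simp: C5_le_iff maxi_def)
    then have "eqv m U C5_r U x"
      using y y' eqv_trans eqv_sym by blast
    then show ?thesis
      using G1_eqv[OF U U] g1[OF x(2)] sgeq eqv_label by metis
  qed
  show "G (\<lambda>x p. fc V x (\<alpha> p)) x = sg V x" for x
    unfolding U_def[symmetric]
  proof (cases "low U x")
    case True
    then show "G U x = sg V x"
      using g_low g1[of x] by (cases "x = C5_r") (auto simp: G_def)
  next
    case False
    then have x: "x = C5_r" using low_not_r U by blast
    have "(G1 U)(C5_r := sg V C5_r) = sg V" using g1 by auto
    moreover have "sg V C5_r \<le> G1 U y" if "y \<noteq> C5_r" for y
      using g1[OF that] persD[OF pers_sg[OF V]] by simp
    ultimately have "good2 U (sg V C5_r)"
      unfolding good2_def using fc_sg_A[OF V] by simp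
    then show "G U x = sg V x"
      using False x lab by (simp add: G_def pick_def)
  qed
qed

text \<open>\<epsilon> defines \<open>G\<close> by formulas: \<open>G_model\<close> makes it a
  unifier, and \<open>G_\<alpha>\<close> says that composing with \<alpha> gives back
  \<sigma>.\<close>

lemma ex_bounded_unifier:
  "\<exists>\<epsilon> \<alpha>. (\<forall>p<n. vars (\<epsilon> p) \<subseteq> {..<m}) \<and>
     (\<forall>V x. pers V \<longrightarrow> fc V x (subst_form \<epsilon> A)) \<and>
     (\<forall>V x p. pers V \<longrightarrow> p < n \<longrightarrow> fc V x (subst_form \<alpha> (\<epsilon> p)) = fc V x (\<sigma> p))"
proof -
  have "\<exists>B. vars B \<subseteq> {..<m} \<and> (\<forall>V x. pers V \<longrightarrow> fc V x B = G V x p)" for p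
  proof (rule definable)
    show "G V x p \<Longrightarrow> G V' x' p" if "pers V" "pers V'" "eqv m V x V' x'" for V V' x x'
      using G_eqv[OF that] by simp
    show "G V x p \<Longrightarrow> G V y p" if "pers V" "le x y" for V x y
      using persD[OF pers_G] that by (auto simp: le_fun_def)
  qed
  then obtain \<epsilon> where \<epsilon>: "\<And>p. vars (\<epsilon> p) \<subseteq> {..<m}"
      "\<And>p V x. pers V \<Longrightarrow> fc V x (\<epsilon> p) = G V x p"
    by metis
  obtain \<alpha> where \<alpha>: "\<And>p. p < n \<Longrightarrow> \<alpha> p = \<sigma> p"
      "\<And>p V x. n \<le> p \<Longrightarrow> pers V \<Longrightarrow> fc V x (\<alpha> p) = (flat k V x \<and> e (p - n) \<in> D (V x))"
    using ex_\<alpha> by blast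
  have "fc V x (subst_form \<epsilon> A)" if "pers V" for V x
    using G_model[OF that, of x] \<epsilon>(2)[OF that] by (simp add: fc_subst)
  moreover have "fc V x (subst_form \<alpha> (\<epsilon> p)) = fc V x (\<sigma> p)" if "pers V" "p < n" for V x p
    using \<epsilon>(2)[OF pers_fc[OF that(1)]] G_\<alpha>[OF \<alpha> that(1)] that(2)
    by (simp add: fc_subst sg_def trunc_def)
  ultimately show ?thesis using \<epsilon>(1) by blast
qed

end

section \<open>Unification type\<close>

lemma in_LC5: "B \<in> LC5 \<longleftrightarrow> (\<forall>V x. pers V \<longrightarrow> fc V x B)"
  by (auto simp: logic_of_def)

lemma Iff_in_LC5: "Iff B C \<in> LC5 \<longleftrightarrow> (\<forall>V x. pers V \<longrightarrow> fc V x B = fc V x C)"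
proof -
  have "fc V x (Iff B C)" if "\<And>V x. pers V \<Longrightarrow> fc V x B = fc V x C" "pers V" for V x
    using that by (simp add: Iff_def)
  moreover have "fc V x B = fc V x C" if "fc V x (Iff B C)" for V x
    using that le_refl[of x] unfolding Iff_def forces.simps by blast
  ultimately show ?thesis unfolding in_LC5 by blast
qed

lemma subst_eq_LC5I:
  assumes "\<And>V x p. pers V \<Longrightarrow> fc V x (\<sigma> p) = fc V x (\<tau> p)"
  shows "subst_eq LC5 \<sigma> \<tau>"
  unfolding subst_eq_def Iff_in_LC5 fc_subst using assms by simp

text \<open>A formula is determined up to equivalence by its truth set on the finitely many
  truncated models; one formula is chosen per truth set.\<close>

lemma finite_representatives:
  "\<exists>F. finite F \<and>
     (\<forall>B. vars B \<subseteq> {..<m} \<longrightarrow> (\<exists>C\<in>F. \<forall>V x. pers V \<longrightarrow> fc V x B = fc V x C))"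
proof -
  define T where "T B = {s \<in> models m \<times> UNIV. fc (fst s) (snd s) B}" for B
  let ?Fm = "{B. vars B \<subseteq> {..<m}}"
  let ?F = "inv_into ?Fm T ` T ` ?Fm"
  have "finite (models m \<times> (UNIV :: C5 set))"
    using finite_models finite_C5 by auto
  then have "finite (T ` ?Fm)"
    by (rule finite_subset[rotated, OF finite_Pow_iff[THEN iffD2]]) (auto simp: T_def)
  then have "finite ?F" by blast
  moreover have "\<exists>C\<in>?F. \<forall>V x. pers V \<longrightarrow> fc V x B = fc V x C" if B: "vars B \<subseteq> {..<m}" for B
  proof (intro bexI allI impI)
    let ?C = "inv_into ?Fm T (T B)"
    have C: "vars ?C \<subseteq> {..<m}" "T ?C = T B"
      using inv_into_into[of "T B" T ?Fm] f_inv_into_f[of "T B" T ?Fm] B by auto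
    show "fc V x B = fc V x ?C" if V: "pers V" for V x
    proof -
      have "fc (truncv m V) x B = fc (truncv m V) x ?C"
        using C(2) truncv_models[OF V, of m] unfolding T_def by (force simp: set_eq_iff)
      then show ?thesis
        using eqv_truncv[of m V x] B C(1) by (auto simp: eqv_def)
    qed
    show "?C \<in> ?F" using B by blast
  qed
  ultimately show ?thesis by blast
qed

lemma finite_complete_unifiers: "\<exists>S. finite S \<and> complete_unifiers LC5 A S"
proof -
  obtain n where n: "vars A \<subseteq> {..<n}"
    using finite_vars[of A] by (auto simp: finite_nat_set_iff_bounded)
  have "finite ({f. trunc n f = f} \<times> {f. trunc n f = f})"
    using finite_labels by blast
  then obtain N :: nat and e where e: "{f. trunc n f = f} \<times> {f. trunc n f = f} = e ` {..<N}"
    by (auto simp: finite_conv_nat_seg_image lessThan_def)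
  define M where "M = n + N"
  obtain F where F: "finite F" "\<And>B. vars B \<subseteq> {..<M} \<Longrightarrow> \<exists>C\<in>F. \<forall>V x. pers V \<longrightarrow> fc V x B = fc V x C"
    using finite_representatives[of M] by blast
  \<comment> \<open>Variables from \<open>n\<close> on are moved to variables from \<open>M\<close>
    on, which do not occur in the bounded values, so that they can be restored
    independently.\<close>
  define ext where "ext f p = (if p < n then f p else Var (M + (p - n)))" for f and p :: nat
  define S where "S = {\<epsilon> \<in> ext ` {f. \<forall>p. (p \<in> {..<n} \<longrightarrow> f p \<in> F) \<and> (p \<notin> {..<n} \<longrightarrow> f p = Falsum)}.
      unifier LC5 A \<epsilon>}"
  have "finite S"
    unfolding S_def
    using finite_set_of_finite_funs[OF finite_lessThan F(1), of n Falsum] by simp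
  moreover have "\<exists>\<epsilon>\<in>S. more_general LC5 \<epsilon> \<sigma>" if \<sigma>: "unifier LC5 A \<sigma>" for \<sigma>
  proof -
    have "finite (\<Union>p<n. vars (\<sigma> p))" using finite_vars by blast
    then obtain k where "\<forall>q\<in>\<Union>p<n. vars (\<sigma> p). q < k"
      unfolding finite_nat_set_iff_bounded by blast
    then have k: "vars (\<sigma> p) \<subseteq> {..<k}" if "p < n" for p
      using that by auto
    interpret bounded_unifier n k N \<sigma> A e
      using n k \<sigma> e by unfold_locales (auto simp: unifier_def in_LC5)
    have M: "m = M" by (simp add: M_def m_def)
    obtain \<epsilon> \<alpha> where h: "\<And>p. p < n \<Longrightarrow> vars (\<epsilon> p) \<subseteq> {..<M}"
        "\<And>V x. pers V \<Longrightarrow> fc V x (subst_form \<epsilon> A)"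
        "\<And>V x p. pers V \<Longrightarrow> p < n \<Longrightarrow> fc V x (subst_form \<alpha> (\<epsilon> p)) = fc V x (\<sigma> p)"
      using ex_bounded_unifier unfolding M by blast
    have "\<forall>p. \<exists>C. p < n \<longrightarrow> C \<in> F \<and> (\<forall>V x. pers V \<longrightarrow> fc V x (\<epsilon> p) = fc V x C)"
      using F(2) h(1) by blast
    then obtain f where f: "\<And>p. p < n \<Longrightarrow> f p \<in> F"
        "\<And>p V x. p < n \<Longrightarrow> pers V \<Longrightarrow> fc V x (\<epsilon> p) = fc V x (f p)"
      by metis
    \<comment> \<open>The default \<open>Falsum\<close> puts \<open>f'\<close> into the finite
      function space defining \<open>S\<close>; \<open>ext\<close> overrides it.\<close>
    define f' where "f' p = (if p < n then f p else Falsum)" for p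
    have "fc V x (subst_form (ext f') A)" if V: "pers V" for V x
    proof -
      have "fc V x (subst_form (ext f') A) = fc V x (subst_form \<epsilon> A)"
        unfolding fc_subst using n f(2) V
        by (intro fc_bisim[where Z = "(=)" and P = "{..<n}"]) (auto simp: ext_def f'_def)
      then show ?thesis using h(2)[OF V] by simp
    qed
    then have "ext f' \<in> S"
      unfolding S_def unifier_def in_LC5 using f(1) by (auto simp: f'_def)
    moreover have "more_general LC5 (ext f') \<sigma>"
      unfolding more_general_def
    proof (intro exI subst_eq_LC5I)
      \<comment> \<open>Inverts the shift made by \<open>ext\<close>: \<open>M + (p - n)\<close>
        goes to \<open>\<sigma> p\<close> for \<open>p\<close> at least \<open>n\<close>.\<close>
      define \<alpha>' where "\<alpha>' p = (if p < M then \<alpha> p else \<sigma> (n + (p - M)))" for p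
      fix V x p assume V: "pers V"
      show "fc V x (subst_comp \<alpha>' (ext f') p) = fc V x (\<sigma> p)"
      proof (cases "p < n")
        case True
        have "fc V x (subst_form \<alpha>' (f p)) = fc V x (subst_form \<alpha>' (\<epsilon> p))"
          unfolding fc_subst using f(2)[OF True pers_fc[OF V]] by simp
        also have "\<dots> = fc V x (subst_form \<alpha> (\<epsilon> p))"
          unfolding fc_subst using h(1)[OF True]
          by (intro fc_bisim[where Z = "(=)" and P = "{..<M}"]) (auto simp: \<alpha>'_def)
        finally show ?thesis
          using h(3)[OF V True] True by (simp add: subst_comp_def ext_def f'_def)
      next
        case False
        then have "\<not> M + p - n < M" "n + (M + p - n - M) = p" by simp_all
        then show ?thesis using False by (simp add: subst_comp_def ext_def \<alpha>'_def)
      qed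
    qed
    ultimately show ?thesis by blast
  qed
  ultimately show ?thesis
    unfolding complete_unifiers_def by (intro exI[of _ S]) (auto simp: S_def)
qed

lemma not_unitary: "\<not> unitary_unification LC5"
proof
  let ?A = "Disj (Var 0) (Impl (Var 0) Falsum)" and ?T = "Impl Falsum Falsum"
  have un: "unifier LC5 ?A (\<lambda>_. ?T)" "unifier LC5 ?A (\<lambda>_. Falsum)"
    by (auto simp: unifier_def in_LC5)
  assume "unitary_unification LC5"
  then obtain \<epsilon> where \<epsilon>: "complete_unifiers LC5 ?A {\<epsilon>}"
    using un unfolding unitary_unification_def unifiable_def by blast
  then have "more_general LC5 \<epsilon> (\<lambda>_. ?T)" "more_general LC5 \<epsilon> (\<lambda>_. Falsum)"
    using un unfolding complete_unifiers_def by simp_all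
  then obtain \<alpha> \<beta> where "subst_eq LC5 (subst_comp \<alpha> \<epsilon>) (\<lambda>_. ?T)"
      "subst_eq LC5 (subst_comp \<beta> \<epsilon>) (\<lambda>_. Falsum)"
    unfolding more_general_def by blast
  then have "\<forall>V x. pers V \<longrightarrow> fc V x (subst_form \<alpha> (\<epsilon> 0))"
      "\<forall>V x. pers V \<longrightarrow> \<not> fc V x (subst_form \<beta> (\<epsilon> 0))"
    unfolding subst_eq_def Iff_in_LC5 by (auto simp: subst_comp_def dest: spec[of _ "Var 0"])
  moreover define U where "U = (\<lambda>(_ :: C5) (_ :: nat). False)"
  moreover have "pers U" by (auto simp: U_def intro: persI)
  ultimately have \<alpha>\<beta>: "fc U C5_c (subst_form \<alpha> (\<epsilon> 0))" "\<not> fc U C5_d (subst_form \<beta> (\<epsilon> 0))"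
    by blast+
  \<comment> \<open>The \<alpha>-image at \<open>C5_c\<close> and the \<beta>-image at
    \<open>C5_d\<close>, persistent as both points are maximal. Then \<open>\<epsilon> 0\<close>
    holds at \<open>C5_c\<close> and fails at \<open>C5_d\<close>, so the root can force neither
    disjunct.\<close>
  define V where "V = (\<lambda>x p. x = C5_c \<and> fc U x (\<alpha> p) \<or> x = C5_d \<and> fc U x (\<beta> p))"
  have "pers V"
    by (rule persI) (auto simp: V_def C5_le_iff le_fun_def)
  then have "fc V C5_r (subst_form \<epsilon> ?A)"
    using \<epsilon> unfolding complete_unifiers_def unifier_def in_LC5 by blast
  moreover have "fc V C5_c (\<epsilon> 0) = fc U C5_c (subst_form \<alpha> (\<epsilon> 0))"
    unfolding fc_subst
    by (rule fc_bisim[where Z = "\<lambda>x y. x = C5_c \<and> y = C5_c" and P = UNIV]) (auto simp: V_def)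
  moreover have "fc V C5_d (\<epsilon> 0) = fc U C5_d (subst_form \<beta> (\<epsilon> 0))"
    unfolding fc_subst
    by (rule fc_bisim[where Z = "\<lambda>x y. x = C5_d \<and> y = C5_d" and P = UNIV]) (auto simp: V_def)
  ultimately have "fc V C5_c (\<epsilon> 0)" "\<not> fc V C5_d (\<epsilon> 0)"
    "fc V C5_r (\<epsilon> 0) \<or> (\<forall>y. fc V y (\<epsilon> 0) \<longrightarrow> False)"
    using \<alpha>\<beta> by simp_all
  then show False
    using fc_mono[OF \<open>pers V\<close> le_r[of C5_d]] by blast
qed

theorem theorem4p10:
  shows "finitary_unification (logic_of (UNIV :: C5 set) C5_le)"
  unfolding finitary_unification_def
  using not_unitary finite_complete_unifiers by blast

end
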